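(* Let $F_2$ and $F_3$ be finite subsets of $\mathbb{Z}^2$. Let $F_1$ be a uniquely determined neighbour of $F_2$, and let $F_1'$ be a uniquely determined neighbour of $F_3$. Put $\alpha_2 = \alpha(F_1,F_2)$, $\alpha_3 = \alpha(F_1', F_3)$ and $\alpha_1 = \alpha(F_1, F_1')$. Then $$|F_2 \bigtriangleup F_3| \leq \alpha_2 \sqrt{8|F_2| + 1} - \alpha_2 + \alpha_3 \sqrt{8|F_3|+1} - \alpha_3 + 2\alpha_1 \sqrt{2\alpha_1 + 1} - \alpha_1.$$
   Context: For $F$ a finite subset of $\mathbb{Z}^2$, the row sum of row $i\in\mathbb{Z}$ is the number of $j \in \mathbb{Z}$ with $(i,j)\in F$, and the column sum of column $j\in\mathbb{Z}$ is the number of $i \in \mathbb{Z}$ with $(i,j)\in F$. The row and column sums together are called the line sums of $F$. A finite set $F\subset\mathbb{Z}^2$ is called uniquely determined (by its line sums) if every subset $F'$ of $\mathbb{Z}^2$ with exactly the same row and column sums as $F$ equals $F$. For finite $F, G\subset \mathbb{Z}^2$ with row sums $r_i^{F}, r_i^{G}$ ($i\in\mathbb{Z}$) and column sums $c_j^{F}, c_j^{G}$ ($j\in\mathbb{Z}$), define $$\alpha(F,G)=\frac12\Big(\sum_{j\in\mathbb{Z}}|c_j^{F}-c_j^{G}|+\sum_{i\in\mathbb{Z}}|r_i^{F}-r_i^{G}|\Big).$$ Uniquely determined neighbour: let $G$ be a finite subset of $\mathbb{Z}^2$ with column sums $c_j$, and let $C$ be a finite set of $n$ column indices containing every column with non-zero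 column sum of $G$. A set $F_1$ is a uniquely determined neighbour of $G$ if $F_1$ is a finite uniquely determined set, $F_1$ has the same row sum as $G$ in every row, all columns of $F_1$ with index outside $C$ are empty, and there is an enumeration $\sigma(1),\ldots,\sigma(n)$ of $C$ with $c_{\sigma(1)}\ge c_{\sigma(2)}\ge\ldots\ge c_{\sigma(n)}$ such that the column sums $v_j$ of $F_1$ satisfy $v_{\sigma(1)}\ge v_{\sigma(2)}\ge\ldots\ge v_{\sigma(n)}$. (This depends only on the line sums of $G$ and not on the choice of $C$.) $\bigtriangleup$ denotes symmetric difference. *)

theory Defs
  imports "HOL-Analysis.Analysis"
begin

text \<open>A point \<open>(i, j)\<close> lies in row \<open>i\<close> and column \<open>j\<close>. Since \<open>card\<close> of an infinite set is
  \<open>0\<close>, the following two functions are the line sums only for finite sets of points.\<close>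

definition row_sum :: "(int \<times> int) set \<Rightarrow> int \<Rightarrow> nat" where
  "row_sum F i = card {j. (i, j) \<in> F}"

definition col_sum :: "(int \<times> int) set \<Rightarrow> int \<Rightarrow> nat" where
  "col_sum F j = card {i. (i, j) \<in> F}"

text \<open>The competitor \<open>F'\<close> is required to be finite only because of the convention for \<open>card\<close>: a
  set with the same line sums (as cardinal numbers) as a finite set has finitely many non-empty
  rows, each of them finite, and so is finite itself.\<close>

definition uniquely_determined :: "(int \<times> int) set \<Rightarrow> bool" where
  "uniquely_determined F \<longleftrightarrow> finite F \<and>
    (\<forall>F'. finite F' \<and> (\<forall>i. row_sum F' i = row_sum F i) \<and> (\<forall>j. col_sum F' j = col_sum F j)
       \<longrightarrow> F' = F)"

text \<open>For finite sets both series have only finitely many non-zero terms.\<close>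

definition alpha :: "(int \<times> int) set \<Rightarrow> (int \<times> int) set \<Rightarrow> real" where
  "alpha F G = 1 / 2 *
    ((\<Sum>\<^sub>\<infinity>j\<in>UNIV. \<bar>real (col_sum F j) - real (col_sum G j)\<bar>) +
     (\<Sum>\<^sub>\<infinity>i\<in>UNIV. \<bar>real (row_sum F i) - real (row_sum G i)\<bar>))"

text \<open>The set \<open>C\<close> of column indices is existentially quantified, as the notion does not depend on
  its choice. One enumeration \<open>\<sigma>\<close> has to sort the column sums of both sets.\<close>

definition ud_neighbour :: "(int \<times> int) set \<Rightarrow> (int \<times> int) set \<Rightarrow> bool" where
  "ud_neighbour F1 G \<longleftrightarrow>
    uniquely_determined F1 \<and>
    (\<forall>i. row_sum F1 i = row_sum G i) \<and>
    (\<exists>C n \<sigma>. finite C \<and> card C = n \<and>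
       {j. col_sum G j \<noteq> 0} \<subseteq> C \<and>
       (\<forall>j. j \<notin> C \<longrightarrow> col_sum F1 j = 0) \<and>
       bij_betw \<sigma> {1..n} C \<and>
       antimono_on {1..n} (\<lambda>k. col_sum G (\<sigma> k)) \<and>
       antimono_on {1..n} (\<lambda>k. col_sum F1 (\<sigma> k)))"

end

theory Submission
  imports Defs
begin

text \<open>By the triangle inequality it suffices to bound the symmetric difference for a neighbour pair
  and for two uniquely determined sets. View \<open>F\<close> and \<open>G\<close> as a digraph on rows and columns with an arc
  from row to column for every point of \<open>F - G\<close> and from column to row for every point of \<open>G - F\<close>.
  Its vertex imbalances have total absolute value \<open>2 * alpha F G\<close> and sum \<open>0\<close>, so a potential with
  values in \<open>[0, M]\<close> drops by at most \<open>M * alpha F G\<close> in total along all arcs. If \<open>F\<close> is uniquely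
  determined, its rows form a chain under inclusion. If it has \<open>p\<close> distinct nonempty rows, then
  \<open>p * (p + 1) \<le> 2 * card F\<close>, and some potential with \<open>M = p\<close> drops along every arc from \<open>F - G\<close>
  and rises along none. If both sets are uniquely determined, the digraph is acyclic and the length of
  a longest path from a vertex is a potential; a path with \<open>n\<close> arcs forces so many chords that
  \<open>(n + 1)\<^sup>2 \<le> 8 * alpha F G + 1\<close>.\<close>

section \<open>Line sums and weighted sums over points\<close>

lemma row_sum_zero_iff: "finite F \<Longrightarrow> row_sum F i = 0 \<longleftrightarrow> i \<notin> fst ` F"
proof -
  assume "finite F"
  moreover have "{j. (i, j) \<in> F} \<subseteq> snd ` F" by force
  ultimately have "finite {j. (i, j) \<in> F}" by (meson finite_imageI finite_subset)
  then show ?thesis unfolding row_sum_def by (force simp: image_iff)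
qed

lemma col_sum_eq_row_sum_converse: "col_sum F j = row_sum (F\<inverse>) j"
  by (simp add: col_sum_def row_sum_def)

lemma sum_fst_eq:
  fixes x :: "int \<Rightarrow> real"
  assumes "finite F" "finite I" "fst ` F \<subseteq> I"
  shows "(\<Sum>(i, j)\<in>F. x i) = (\<Sum>i\<in>I. real (row_sum F i) * x i)"
proof -
  have "(\<Sum>(i, j)\<in>F. x i) = (\<Sum>i\<in>I. \<Sum>p\<in>{p\<in>F. fst p = i}. x (fst p))"
    using sum.group[OF assms, of "\<lambda>p. x (fst p)"] by (simp add: case_prod_beta)
  also have "\<dots> = (\<Sum>i\<in>I. real (row_sum F i) * x i)"
  proof (rule sum.cong)
    fix i
    have "{p\<in>F. fst p = i} = Pair i ` {j. (i, j) \<in> F}" by force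
    then have "card {p\<in>F. fst p = i} = row_sum F i"
      by (simp add: row_sum_def card_image inj_on_def)
    then show "(\<Sum>p\<in>{p\<in>F. fst p = i}. x (fst p)) = real (row_sum F i) * x i" by simp
  qed simp
  finally show ?thesis .
qed

lemma card_eq_sum_row_sum:
  assumes "finite F" "finite I" "fst ` F \<subseteq> I"
  shows "card F = (\<Sum>i\<in>I. row_sum F i)"
proof -
  have "real (card F) = real (\<Sum>i\<in>I. row_sum F i)"
    using sum_fst_eq[OF assms, of "\<lambda>_. 1"] by simp
  then show ?thesis by linarith
qed

lemma card_eq_if_row_sums_eq:
  assumes "finite F" "finite G" "\<And>i. row_sum F i = row_sum G i"
  shows "card F = card G"
  using assms card_eq_sum_row_sum[of F "fst ` F \<union> fst ` G"]
    card_eq_sum_row_sum[of G "fst ` F \<union> fst ` G"] by simp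

text \<open>Grouping points by row turns the left side into a finite sum over row-sum differences;
  rows meeting neither set contribute nothing to the series.\<close>

lemma sum_row_difference_le:
  fixes x :: "int \<Rightarrow> real"
  assumes "finite F" "finite G" "\<And>i. \<bar>x i\<bar> \<le> b"
  shows "(\<Sum>(i, j)\<in>F. x i) - (\<Sum>(i, j)\<in>G. x i)
    \<le> b * (\<Sum>\<^sub>\<infinity>i\<in>UNIV. \<bar>real (row_sum F i) - real (row_sum G i)\<bar>)"
proof -
  define I where "I = fst ` F \<union> fst ` G"
  have I: "finite I" "fst ` F \<subseteq> I" "fst ` G \<subseteq> I" using assms by (auto simp: I_def)
  have "(\<Sum>(i, j)\<in>F. x i) - (\<Sum>(i, j)\<in>G. x i)
      = (\<Sum>i\<in>I. (real (row_sum F i) - real (row_sum G i)) * x i)"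
    using sum_fst_eq[of F I x] sum_fst_eq[of G I x] assms I
    by (simp add: sum_subtractf left_diff_distrib)
  also have "\<dots> \<le> (\<Sum>i\<in>I. b * \<bar>real (row_sum F i) - real (row_sum G i)\<bar>)"
  proof (rule sum_mono)
    fix i
    have "(real (row_sum F i) - real (row_sum G i)) * x i
        \<le> \<bar>real (row_sum F i) - real (row_sum G i)\<bar> * \<bar>x i\<bar>"
      by (metis abs_ge_self abs_mult)
    also have "\<dots> \<le> \<bar>real (row_sum F i) - real (row_sum G i)\<bar> * b"
      using assms(3) by (intro mult_left_mono) auto
    finally show "(real (row_sum F i) - real (row_sum G i)) * x i
        \<le> b * \<bar>real (row_sum F i) - real (row_sum G i)\<bar>" by (simp add: mult.commute)
  qed
  also have "\<dots> = b * (\<Sum>i\<in>I. \<bar>real (row_sum F i) - real (row_sum G i)\<bar>)"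
    by (simp add: sum_distrib_left)
  also have "(\<Sum>i\<in>I. \<bar>real (row_sum F i) - real (row_sum G i)\<bar>)
      = (\<Sum>\<^sub>\<infinity>i\<in>I. \<bar>real (row_sum F i) - real (row_sum G i)\<bar>)"
    using I by simp
  also have "\<dots> = (\<Sum>\<^sub>\<infinity>i\<in>UNIV. \<bar>real (row_sum F i) - real (row_sum G i)\<bar>)"
    using assms by (intro infsum_cong_neutral) (auto simp: I_def row_sum_zero_iff[THEN iffD2])
  finally show ?thesis .
qed

lemma sum_col_difference_le:
  fixes y :: "int \<Rightarrow> real"
  assumes "finite F" "finite G" "\<And>j. \<bar>y j\<bar> \<le> b"
  shows "(\<Sum>(i, j)\<in>F. y j) - (\<Sum>(i, j)\<in>G. y j)
    \<le> b * (\<Sum>\<^sub>\<infinity>j\<in>UNIV. \<bar>real (col_sum F j) - real (col_sum G j)\<bar>)"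
proof -
  have swap: "(\<Sum>(j, i)\<in>H\<inverse>. y j) = (\<Sum>(i, j)\<in>H. y j)" for H :: "(int \<times> int) set"
    by (rule sum.reindex_bij_witness[of _ prod.swap prod.swap]) auto
  show ?thesis
    using sum_row_difference_le[of "F\<inverse>" "G\<inverse>" y b] assms
    by (simp add: col_sum_eq_row_sum_converse swap)
qed

lemma alpha_nonneg: "0 \<le> alpha F G"
  unfolding alpha_def by (intro mult_nonneg_nonneg add_nonneg_nonneg infsum_nonneg) auto

section \<open>The difference digraph and potentials\<close>

text \<open>The difference of two sets as a digraph whose vertices are the rows (\<open>Inl\<close>) and the columns
  (\<open>Inr\<close>). Out-degree minus in-degree is the difference of the row sums at a row, and the negated
  difference of the column sums at a column.\<close>

definition arcs :: "(int \<times> int) set \<Rightarrow> (int \<times> int) set \<Rightarrow> ((int + int) \<times> (int + int)) set" where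
  "arcs F G = (\<lambda>(i, j). (Inl i, Inr j)) ` (F - G) \<union> (\<lambda>(i, j). (Inr j, Inl i)) ` (G - F)"

lemma finite_arcs: "finite F \<Longrightarrow> finite G \<Longrightarrow> finite (arcs F G)"
  by (simp add: arcs_def)

lemma sum_arcs:
  fixes h :: "int + int \<Rightarrow> int + int \<Rightarrow> real"
  assumes "finite F" "finite G"
  shows "(\<Sum>(u, v)\<in>arcs F G. h u v)
    = (\<Sum>(i, j)\<in>F - G. h (Inl i) (Inr j)) + (\<Sum>(i, j)\<in>G - F. h (Inr j) (Inl i))"
proof -
  have inj: "inj_on (\<lambda>(i, j). (Inl i, Inr j)) (F - G)" "inj_on (\<lambda>(i, j). (Inr j, Inl i)) (G - F)"
    by (auto simp: inj_on_def)
  have "(\<Sum>(u, v)\<in>arcs F G. h u v)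
      = (\<Sum>(u, v)\<in>(\<lambda>(i, j). (Inl i, Inr j)) ` (F - G). h u v)
      + (\<Sum>(u, v)\<in>(\<lambda>(i, j). (Inr j, Inl i)) ` (G - F). h u v)"
    unfolding arcs_def using assms by (intro sum.union_disjoint) auto
  then show ?thesis
    by (simp only: sum.reindex[OF inj(1)] sum.reindex[OF inj(2)]) (simp add: case_prod_unfold)
qed

lemma card_arcs:
  assumes "finite F" "finite G"
  shows "card (arcs F G) = card (sym_diff F G)"
proof -
  have "real (card (arcs F G)) = real (card (F - G)) + real (card (G - F))"
    using sum_arcs[OF assms, of "\<lambda>_ _. 1"] by simp
  also have "\<dots> = real (card (sym_diff F G))"
    using assms by (subst card_Un_disjoint) auto
  finally show ?thesis by linarith
qed

lemma sum_potential_le: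
  fixes \<phi> :: "int + int \<Rightarrow> real"
  assumes fin: "finite F" "finite G" and \<phi>: "\<And>v. 0 \<le> \<phi> v" "\<And>v. \<phi> v \<le> M"
  shows "(\<Sum>(u, v)\<in>arcs F G. \<phi> u - \<phi> v) \<le> M * alpha F G"
proof -
  \<comment> \<open>Centring at \<open>M / 2\<close> leaves differences along arcs unchanged and
    bounds all weights by \<open>M / 2\<close>, which fits the factor \<open>1 / 2\<close> in
    \<open>alpha\<close>.\<close>
  define x where "x i = \<phi> (Inl i) - M / 2" for i
  define y where "y j = M / 2 - \<phi> (Inr j)" for j
  have b: "\<bar>x i\<bar> \<le> M / 2" "\<bar>y i\<bar> \<le> M / 2" for i
    using \<phi>[of "Inl i"] \<phi>[of "Inr i"] unfolding x_def y_def by linarith+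
  have "(\<Sum>(u, v)\<in>arcs F G. \<phi> u - \<phi> v)
      = (\<Sum>(i, j)\<in>F - G. x i + y j) - (\<Sum>(i, j)\<in>G - F. x i + y j)"
    unfolding sum_arcs[OF fin, of "\<lambda>u v. \<phi> u - \<phi> v"] by (simp add: x_def y_def case_prod_unfold flip: sum_negf)
  also have "\<dots> = (\<Sum>(i, j)\<in>F. x i + y j) - (\<Sum>(i, j)\<in>G. x i + y j)"
    using fin sum.Int_Diff[of F "\<lambda>(i, j). x i + y j" G] sum.Int_Diff[of G "\<lambda>(i, j). x i + y j" F]
    by (simp add: Int_commute)
  also have "\<dots> = ((\<Sum>(i, j)\<in>F. x i) - (\<Sum>(i, j)\<in>G. x i))
      + ((\<Sum>(i, j)\<in>F. y j) - (\<Sum>(i, j)\<in>G. y j))"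
    by (simp add: sum.distrib case_prod_unfold)
  also have "\<dots> \<le> M * alpha F G"
    using sum_row_difference_le[OF fin, of x, OF b(1)] sum_col_difference_le[OF fin, of y, OF b(2)]
    by (simp add: alpha_def algebra_simps)
  finally show ?thesis .
qed

section \<open>Distance from a uniquely determined set\<close>

lemma row_sum_switch:
  assumes F: "finite F" and "(i, j) \<in> F" "(k, l) \<in> F" "(i, l) \<notin> F" "(k, j) \<notin> F"
  shows "row_sum (F - {(i, j), (k, l)} \<union> {(i, l), (k, j)}) m = row_sum F m"
proof -
  have fin: "finite {b. (a, b) \<in> F}" for a
    by (rule finite_subset[OF _ finite_imageI[OF F, of snd]]) force
  have "i \<noteq> k" "j \<noteq> l" using assms by auto
  let ?F' = "F - {(i, j), (k, l)} \<union> {(i, l), (k, j)}"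
  consider "m = i" | "m = k" | "m \<noteq> i" "m \<noteq> k" by auto
  then show ?thesis
  proof cases
    case 1
    have "{b. (i, b) \<in> ?F'} = insert l ({b. (i, b) \<in> F} - {j})" using \<open>i \<noteq> k\<close> by auto
    then show ?thesis
      unfolding row_sum_def 1 using card_Suc_Diff1[OF fin[of i], of j] assms fin by simp
  next
    case 2
    have "{b. (k, b) \<in> ?F'} = insert j ({b. (k, b) \<in> F} - {l})" using \<open>i \<noteq> k\<close> by auto
    then show ?thesis
      unfolding row_sum_def 2 using card_Suc_Diff1[OF fin[of k], of l] assms fin by simp
  next
    case 3
    then show ?thesis by (simp add: row_sum_def)
  qed
qed

text \<open>Otherwise exchanging opposite corners of a rectangle would change \<open>F\<close> but
  keep all its line sums.\<close>

lemma uniquely_determined_no_switch: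
  assumes "uniquely_determined F" "(i, j) \<in> F" "(k, l) \<in> F" "(k, j) \<notin> F"
  shows "(i, l) \<in> F"
proof (rule ccontr)
  assume il: "(i, l) \<notin> F"
  let ?F' = "F - {(i, j), (k, l)} \<union> {(i, l), (k, j)}"
  have fin: "finite F" using assms(1) by (simp add: uniquely_determined_def)
  have "row_sum ?F' m = row_sum F m" for m
    using row_sum_switch fin assms il by blast
  moreover have "col_sum ?F' m = col_sum F m" for m
  proof -
    \<comment> \<open>The transpose of a switch is again a switch, so the statement on rows also
      covers columns.\<close>
    have conv: "?F'\<inverse> = F\<inverse> - {(j, i), (l, k)} \<union> {(j, k), (l, i)}" by auto
    show ?thesis
      using row_sum_switch[of "F\<inverse>" j i l k m] fin assms il
      unfolding col_sum_eq_row_sum_converse conv by simp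
  qed
  ultimately have "?F' = F"
    using assms(1) fin unfolding uniquely_determined_def
    by (metis finite.emptyI finite_Diff finite_Un finite_insert)
  then show False using il by blast
qed

text \<open>Induction adding the maximum \<open>b\<close>: the enlarged set lies in
  \<open>{1..b}\<close>, so \<open>b\<close> is at least its cardinality.\<close>

lemma sum_ge_triangle:
  fixes S :: "nat set"
  assumes "finite S" "0 \<notin> S"
  shows "card S * (card S + 1) \<le> 2 * \<Sum>S"
  using assms
proof (induction S rule: finite_linorder_max_induct)
  case (insert b A)
  have "insert b A \<subseteq> {1..b}" using insert.hyps insert.prems by (auto simp: Suc_le_eq less_imp_le intro: gr0I)
  then have "card (insert b A) \<le> card {1..b}" by (intro card_mono) auto
  moreover have "b \<notin> A" using insert by auto
  ultimately show ?case using insert by simp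
qed simp

lemma card_diff_le_uniquely_determined:
  assumes ud: "uniquely_determined F" and G: "finite G"
  shows "2 * real (card (F - G)) \<le> alpha F G * (sqrt (8 * real (card F) + 1) - 1)"
proof -
  define R where "R i = {j. (i, j) \<in> F}" for i
  define S where "S = R ` fst ` F"
  define p where "p = card S"
  have F: "finite F" using ud by (simp add: uniquely_determined_def)
  have finR: "finite (R i)" for i
    unfolding R_def by (rule finite_subset[OF _ finite_imageI[OF F, of snd]]) force
  have finS: "finite S" using F by (simp add: S_def)
  have chain: "R i \<subseteq> R k \<or> R k \<subseteq> R i" for i k
    using uniquely_determined_no_switch[OF ud] unfolding R_def by blast

  \<comment> \<open>In a chain, finite sets of equal size coincide, so the \<open>p\<close> distinct
    nonempty rows have distinct positive sizes.\<close>
  have "inj_on card S"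
    unfolding S_def by (rule inj_onI) (metis (no_types, lifting) chain finR card_subset_eq imageE)
  then have "p = card (card ` S)" and sum: "\<Sum>(card ` S) = (\<Sum>A\<in>S. card A)"
    by (simp_all add: p_def card_image sum.reindex)
  moreover have "0 \<notin> card ` S" using finR by (force simp: S_def R_def)
  ultimately have "p * (p + 1) \<le> 2 * (\<Sum>A\<in>S. card A)"
    using sum_ge_triangle[of "card ` S"] finS by simp
  also have "(\<Sum>A\<in>S. card A) \<le> (\<Sum>i\<in>fst ` F. card (R i))"
    unfolding S_def using F sum_image_le[of "fst ` F" card R] by simp
  also have "\<dots> = card F"
    using card_eq_sum_row_sum[OF F, of "fst ` F"] F by (simp add: R_def row_sum_def)
  finally have "p * (p + 1) \<le> 2 * card F" by simp
  then have "real (p * (p + 1)) \<le> real (2 * card F)" by (simp only: of_nat_le_iff)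
  \<comment> \<open>Completing the square: \<open>4 * p * (p + 1) + 1\<close> is the square of
    \<open>2 * p + 1\<close>.\<close>
  then have "(2 * real p + 1)\<^sup>2 \<le> 8 * real (card F) + 1"
    by (simp add: power2_eq_square algebra_simps)
  then have p: "2 * real p \<le> sqrt (8 * real (card F) + 1) - 1"
    using real_le_rsqrt by fastforce

  \<comment> \<open>A row counts the members of \<open>S\<close> inside it, a column those that miss
    it. If (i, j) is in \<open>F\<close>, the chain puts every member missing \<open>j\<close>
    inside \<open>R i\<close>, and \<open>R i\<close> itself counts in addition; if not, every
    member inside \<open>R i\<close> misses \<open>j\<close>.\<close>
  define \<phi> :: "int + int \<Rightarrow> real" where
    "\<phi> = case_sum (\<lambda>i. card {A\<in>S. A \<subseteq> R i}) (\<lambda>j. card {A\<in>S. j \<notin> A})"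
  have "0 \<le> \<phi> v \<and> \<phi> v \<le> p" for v
    by (cases v) (auto simp: \<phi>_def p_def finS intro!: card_mono)
  then have "(\<Sum>(u, v)\<in>arcs F G. \<phi> u - \<phi> v) \<le> real p * alpha F G"
    using F G by (intro sum_potential_le) auto
  moreover have "\<phi> (Inl i) - \<phi> (Inr j) \<ge> 1" if "(i, j) \<in> F" for i j
  proof -
    have "{A\<in>S. j \<notin> A} \<subset> {A\<in>S. A \<subseteq> R i}"
    proof
      show "{A\<in>S. j \<notin> A} \<subseteq> {A\<in>S. A \<subseteq> R i}"
        using chain[of i] that unfolding S_def by (auto simp: R_def)
      have "R i \<in> S" "j \<in> R i" using that by (force simp: S_def R_def)+
      then show "{A\<in>S. j \<notin> A} \<noteq> {A\<in>S. A \<subseteq> R i}" by blast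
    qed
    then have "card {A\<in>S. j \<notin> A} < card {A\<in>S. A \<subseteq> R i}"
      using finS by (intro psubset_card_mono) auto
    then show ?thesis by (simp add: \<phi>_def)
  qed
  then have "(\<Sum>(i, j)\<in>F - G. \<phi> (Inl i) - \<phi> (Inr j)) \<ge> (\<Sum>(i, j)\<in>F - G. 1)"
    by (intro sum_mono) auto
  moreover have "\<phi> (Inr j) - \<phi> (Inl i) \<ge> 0" if "(i, j) \<notin> F" for i j
  proof -
    have "{A\<in>S. A \<subseteq> R i} \<subseteq> {A\<in>S. j \<notin> A}" using that by (auto simp: R_def)
    then show ?thesis using finS by (auto simp: \<phi>_def intro!: card_mono)
  qed
  then have "(\<Sum>(i, j)\<in>G - F. \<phi> (Inr j) - \<phi> (Inl i)) \<ge> 0"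
    by (intro sum_nonneg) auto
  ultimately have "real (card (F - G)) \<le> real p * alpha F G"
    using sum_arcs[OF F G, of "\<lambda>u v. \<phi> u - \<phi> v"] by (simp add: case_prod_unfold)
  then have "2 * real (card (F - G)) \<le> alpha F G * (2 * real p)" by (simp add: mult.commute)
  also have "\<dots> \<le> alpha F G * (sqrt (8 * real (card F) + 1) - 1)"
    using p alpha_nonneg by (rule mult_left_mono)
  finally show ?thesis .
qed

text \<open>Equal row sums give equal cardinalities, so \<open>F - G\<close> and
  \<open>G - F\<close> have the same size and twice the bound for one of them suffices.\<close>

lemma card_sym_diff_neighbour_le:
  assumes "finite G" "ud_neighbour F G"
  shows "real (card (sym_diff F G)) \<le> alpha F G * sqrt (8 * real (card G) + 1) - alpha F G"
proof -
  have ud: "uniquely_determined F" and "finite F" and card: "card F = card G"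
    using assms card_eq_if_row_sums_eq[of F G]
    by (auto simp: ud_neighbour_def uniquely_determined_def)
  then have "card (F - G) = card (G - F)"
    using assms by (simp add: card_Diff_subset_Int Int_commute)
  moreover have "card (sym_diff F G) = card (F - G) + card (G - F)"
    using assms \<open>finite F\<close> by (intro card_Un_disjoint) auto
  ultimately show ?thesis
    using card_diff_le_uniquely_determined[OF ud assms(1)] card by (simp add: algebra_simps)
qed

section \<open>Paths between two uniquely determined sets\<close>

lemma arcs_iff [simp]:
  "(Inl i, Inr j) \<in> arcs F G \<longleftrightarrow> (i, j) \<in> F - G"
  "(Inr j, Inl i) \<in> arcs F G \<longleftrightarrow> (i, j) \<in> G - F"
  "(Inl i, Inl k) \<notin> arcs F G"
  "(Inr j, Inr l) \<notin> arcs F G"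
  by (force simp: arcs_def)+

lemma arcs_asym: "(u, v) \<in> arcs F G \<Longrightarrow> (v, u) \<notin> arcs F G"
  by (cases u; cases v) auto

text \<open>The vertices span a rectangle with three corners given by the arcs. Absence of switches
  in \<open>F\<close> and in \<open>G\<close> decides membership of the fourth corner in each
  set.\<close>

lemma arcs_cube:
  assumes ud: "uniquely_determined F" "uniquely_determined G"
    and "(a, b) \<in> arcs F G" "(b, c) \<in> arcs F G" "(c, d) \<in> arcs F G"
  shows "(a, d) \<in> arcs F G"
  using assms(3-5)
  by (cases a; cases b; cases c; cases d)
    (auto intro: uniquely_determined_no_switch[OF ud(1)] uniquely_determined_no_switch[OF ud(2)]
      dest: uniquely_determined_no_switch[OF ud(1)] uniquely_determined_no_switch[OF ud(2)])

lemma arcs_path_odd: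
  assumes ud: "uniquely_determined F" "uniquely_determined G"
    and path: "\<forall>k<n. (f k, f (Suc k)) \<in> arcs F G"
    and "k + 2 * d + 1 \<le> n"
  shows "(f k, f (k + 2 * d + 1)) \<in> arcs F G"
  using assms(4)
proof (induction d)
  case 0
  then show ?case using path by simp
next
  case (Suc d)
  then have "(f k, f (k + 2 * d + 1)) \<in> arcs F G"
    and "(f (k + 2 * d + 1), f (k + 2 * d + 2)) \<in> arcs F G"
    and "(f (k + 2 * d + 2), f (k + 2 * d + 3)) \<in> arcs F G"
    using path[rule_format, of "k + 2 * d + 1"] path[rule_format, of "k + 2 * d + 2"]
    by (simp_all add: eval_nat_numeral)
  from arcs_cube[OF ud this] show ?case by (simp add: eval_nat_numeral)
qed

text \<open>A repetition at even distance yields the reverse of the last arc before it, and one at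
  odd distance yields a loop; \<open>arcs_asym\<close> excludes both.\<close>

lemma arcs_path_neq:
  assumes ud: "uniquely_determined F" "uniquely_determined G"
    and path: "\<forall>k<n. (f k, f (Suc k)) \<in> arcs F G"
    and kl: "k < l" "l \<le> n"
  shows "f k \<noteq> f l"
proof
  assume eq: "f k = f l"
  show False
  proof (cases "even (l - k)")
    case True
    then obtain d where "l - k = 2 * d" by blast
    then have "k + 2 * (d - 1) + 1 = l - 1" using kl by (cases d) auto
    then have "(f k, f (l - 1)) \<in> arcs F G"
      using arcs_path_odd[OF ud path, of k "d - 1"] kl by simp
    moreover have "(f (l - 1), f k) \<in> arcs F G"
      using path[rule_format, of "l - 1"] eq kl by simp
    ultimately show False using arcs_asym by blast
  next
    case False
    then obtain d where "l - k = 2 * d + 1" by (elim oddE)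
    then have "k + 2 * d + 1 = l" using kl by simp
    then have "(f k, f l) \<in> arcs F G" using arcs_path_odd[OF ud path, of k d] kl by simp
    then show False using eq arcs_asym by metis
  qed
qed

lemma acyclic_arcs:
  assumes ud: "uniquely_determined F" "uniquely_determined G"
  shows "acyclic (arcs F G)"
proof (rule acyclicI, intro allI notI)
  fix v assume "(v, v) \<in> (arcs F G)\<^sup>+"
  then obtain n where "n > 0" "(v, v) \<in> arcs F G ^^ n" using trancl_power by blast
  then obtain f where "f 0 = v" "f n = v" "\<forall>k<n. (f k, f (Suc k)) \<in> arcs F G"
    unfolding relpow_fun_conv by blast
  then show False using arcs_path_neq[OF ud, of n f 0 n] \<open>n > 0\<close> by simp
qed

text \<open>Twice the indicator of an even sum is \<open>1 + (-1) ^ (a + b)\<close>, and the signs factor.\<close>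

lemma card_even_pairs_ge:
  "real p * real q \<le> 2 * real (card {(a, b) \<in> {..<p} \<times> {..<q}. even (a + b)})"
proof -
  have alt: "(\<Sum>a<m. (- 1) ^ a :: real) = of_bool (odd m)" for m :: nat
    by (induction m) auto
  have "2 * real (card {(a, b) \<in> {..<p} \<times> {..<q}. even (a + b)})
      = (\<Sum>(a, b)\<in>{..<p} \<times> {..<q}. 2 * of_bool (even (a + b)))"
    by (simp add: case_prod_unfold sum.If_cases of_bool_def Int_def mem_Times_iff flip: sum_distrib_left)
  also have "\<dots> = (\<Sum>(a, b)\<in>{..<p} \<times> {..<q}. 1 + (- 1) ^ a * (- 1) ^ b)"
    by (rule sum.cong) (auto simp flip: power_add)
  also have "\<dots> = real p * real q + (\<Sum>a<p. (- 1) ^ a) * (\<Sum>b<q. (- 1) ^ b)"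
    by (simp add: sum_product sum.cartesian_product sum.distrib case_prod_unfold)
  finally show ?thesis by (simp add: alt)
qed

text \<open>Vertices of a path at odd distance are adjacent, so about half of the pairs of path vertices
  on different sides of a cut through the middle are arcs; a cut is crossed by at most \<open>alpha\<close> arcs.\<close>

lemma arcs_path_length:
  assumes ud: "uniquely_determined F" "uniquely_determined G"
    and "(u, v) \<in> arcs F G ^^ n"
  shows "(real n + 1)\<^sup>2 \<le> 8 * alpha F G + 1"
proof (cases "n = 0")
  case True
  then show ?thesis using alpha_nonneg by simp
next
  case False
  let ?E = "arcs F G"
  have fin: "finite F" "finite G" using ud by (auto simp: uniquely_determined_def)
  obtain f where path: "\<forall>k<n. (f k, f (Suc k)) \<in> ?E"
    using assms(3) unfolding relpow_fun_conv by blast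
  have inj: "inj_on f {..n}"
    using arcs_path_neq[OF ud path]
    by (intro linorder_inj_onI) auto
  have reach: "(f k, f l) \<in> ?E\<^sup>*" if "k \<le> l" "l \<le> n" for k l
    using that
  proof (induction l rule: dec_induct)
    case (step l)
    then show ?case using path[rule_format, of l] by (simp add: rtrancl.rtrancl_into_rtrancl)
  qed simp

  define t where "t = (n + 1) div 2"
  have t: "0 < t" "t \<le> n" using False by (auto simp: t_def)
  \<comment> \<open>All predecessors of a vertex of \<open>T\<close> lie in \<open>T\<close>, so no
    arc enters \<open>T\<close> and its indicator is a potential with bound 1. Acyclicity keeps the
    second half of the path outside.\<close>
  define T where "T = {v. (v, f (t - 1)) \<in> ?E\<^sup>*}"
  have below: "f k \<in> T" if "k < t" for k
    using reach[of k "t - 1"] that t by (auto simp: T_def)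
  have above: "f l \<notin> T" if "t \<le> l" "l \<le> n" for l
  proof
    assume "f l \<in> T"
    then have "(f t, f (t - 1)) \<in> ?E\<^sup>*" using reach[OF that] by (auto simp: T_def)
    moreover have "(f (t - 1), f t) \<in> ?E" using path[rule_format, of "t - 1"] t by simp
    ultimately show False
      using acyclic_arcs[OF ud] unfolding acyclic_def by (meson rtrancl_into_trancl2)
  qed
  have closed: "u \<in> T" if "(u, v) \<in> ?E" "v \<in> T" for u v
    using that unfolding T_def by (auto intro: converse_rtrancl_into_rtrancl)

  \<comment> \<open>\<open>a\<close> counts backwards from \<open>t - 1\<close> and \<open>b\<close>
    forwards from \<open>t\<close>, so the distance \<open>a + b + 1\<close> is odd exactly when
    \<open>a + b\<close> is even.\<close>
  define P where "P = {(a, b) \<in> {..<t} \<times> {..<n + 1 - t}. even (a + b)}"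
  define g where "g = (\<lambda>(a, b). (f (t - 1 - a), f (t + b)))"
  have "inj_on g P"
  proof (rule inj_onI, clarsimp simp: g_def P_def)
    fix a b a' b'
    assume *: "a < t" "b < Suc n - t" "a' < t" "b' < Suc n - t"
      "f (t - Suc a) = f (t - Suc a')" "f (t + b) = f (t + b')"
    have "t - Suc a = t - Suc a'" "t + b = t + b'"
      using * t inj_onD[OF inj, of "t - Suc a" "t - Suc a'"] inj_onD[OF inj, of "t + b" "t + b'"]
      by auto
    then show "a = a' \<and> b = b'" using * by auto
  qed
  have "g ` P \<subseteq> ?E \<inter> T \<times> (- T)"
  proof (rule image_subsetI)
    fix c assume "c \<in> P"
    then obtain a b where c: "c = (a, b)" and *: "a < t" "b < Suc n - t" "even (a + b)"
      unfolding P_def by auto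
    then obtain d where "a + b = 2 * d" by blast
    then have "t - Suc a + 2 * d + 1 = t + b" using * by simp
    then have "(f (t - Suc a), f (t + b)) \<in> ?E"
      using arcs_path_odd[OF ud path, of "t - Suc a" d] * by simp
    then show "g c \<in> ?E \<inter> T \<times> (- T)" using below above * by (simp add: g_def c)
  qed
  then have "card P \<le> card (?E \<inter> T \<times> (- T))"
    using \<open>inj_on g P\<close> finite_arcs[OF fin] by (metis card_image card_mono finite_Int)
  also have "real (card (?E \<inter> T \<times> (- T))) = (\<Sum>(u, v)\<in>?E. of_bool (u \<in> T) - of_bool (v \<in> T))"
  proof -
    have "(\<Sum>(u, v)\<in>?E. of_bool (u \<in> T) - of_bool (v \<in> T)) = (\<Sum>e\<in>?E. of_bool (e \<in> T \<times> (- T)) :: real)"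
      by (rule sum.cong) (auto dest: closed)
    then show ?thesis using finite_arcs[OF fin] by (simp add: of_bool_def sum.If_cases Int_def)
  qed
  also have "\<dots> \<le> 1 * alpha F G"
    by (rule sum_potential_le[OF fin]) auto
  finally have "real (card P) \<le> alpha F G" by simp
  then have "real t * real (n + 1 - t) \<le> 2 * alpha F G"
    using card_even_pairs_ge[of t "n + 1 - t"] unfolding P_def by linarith
  \<comment> \<open>The near-equal split loses at most 1: for odd \<open>n + 1\<close> this is an
    equality.\<close>
  moreover have "(n + 1)\<^sup>2 \<le> 4 * (t * (n + 1 - t)) + 1"
  proof (cases "even (n + 1)")
    case True
    then obtain d where "n + 1 = 2 * d" by blast
    then show ?thesis by (simp add: t_def power2_eq_square)
  next
    case False
    then obtain d where "n + 1 = 2 * d + 1" by (elim oddE)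
    then show ?thesis by (simp add: t_def power2_eq_square algebra_simps)
  qed
  then have "real ((n + 1)\<^sup>2) \<le> real (4 * (t * (n + 1 - t)) + 1)" by (simp only: of_nat_le_iff)
  ultimately show ?thesis by (simp add: add.commute)
qed

lemma card_sym_diff_uniquely_determined_le:
  assumes ud: "uniquely_determined F" "uniquely_determined G"
  shows "real (card (sym_diff F G)) \<le> alpha F G * (sqrt (8 * alpha F G + 1) - 1)"
proof -
  let ?E = "arcs F G" and ?a = "sqrt (8 * alpha F G + 1) - 1"
  have fin: "finite F" "finite G" using ud by (auto simp: uniquely_determined_def)
  have len: "real n \<le> ?a" if "v \<in> Domain (?E ^^ n)" for v n
    using that arcs_path_length[OF ud] real_le_rsqrt by (fastforce simp: le_diff_eq)
  define \<phi> where "\<phi> v = Max {n. v \<in> Domain (?E ^^ n)}" for v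
  have bdd: "finite {n. v \<in> Domain (?E ^^ n)}" for v
  proof -
    obtain N :: nat where "?a \<le> real N" using real_arch_simple by blast
    then have "{n. v \<in> Domain (?E ^^ n)} \<subseteq> {..N}" using len by fastforce
    then show ?thesis using finite_subset by blast
  qed
  \<comment> \<open>The empty path and the length bound make \<open>Max\<close> a genuine
    maximum.\<close>
  have ne: "0 \<in> {n. v \<in> Domain (?E ^^ n)}" for v by auto
  have \<phi>: "v \<in> Domain (?E ^^ \<phi> v)" for v
    using Max_in[OF bdd[of v]] ne[of v] unfolding \<phi>_def by blast
  have step: "1 \<le> real (\<phi> u) - real (\<phi> v)" if "(u, v) \<in> ?E" for u v
  proof -
    \<comment> \<open>Prepending the arc to a longest path from \<open>v\<close> gives a longer path
      from \<open>u\<close>.\<close>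
    obtain w where "(v, w) \<in> ?E ^^ \<phi> v" using \<phi>[of v] by blast
    then have "(u, w) \<in> ?E ^^ Suc (\<phi> v)" using that by (rule relpow_Suc_I2[rotated])
    then have "Suc (\<phi> v) \<le> \<phi> u"
      unfolding \<phi>_def[of u] by (intro Max_ge bdd) blast
    then show ?thesis by linarith
  qed
  have "real (card ?E) = (\<Sum>(u, v)\<in>?E. 1)" by simp
  also have "\<dots> \<le> (\<Sum>(u, v)\<in>?E. real (\<phi> u) - real (\<phi> v))"
    by (rule sum_mono) (auto dest: step)
  also have "\<dots> \<le> ?a * alpha F G"
    using len[OF \<phi>] by (intro sum_potential_le[OF fin]) auto
  finally show ?thesis by (simp add: card_arcs[OF fin] mult.commute)
qed

section \<open>Combination of the three bounds\<close>

theorem theorem7: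
  fixes F2 F3 F1 F1' :: "(int \<times> int) set"
    and \<alpha>1 \<alpha>2 \<alpha>3 :: real
  assumes "finite F2" and "finite F3"
    and "ud_neighbour F1 F2"
    and "ud_neighbour F1' F3"
    and "\<alpha>2 = alpha F1 F2"
    and "\<alpha>3 = alpha F1' F3"
    and "\<alpha>1 = alpha F1 F1'"
  shows "real (card (sym_diff F2 F3)) \<le>
    \<alpha>2 * sqrt (8 * real (card F2) + 1) - \<alpha>2
    + \<alpha>3 * sqrt (8 * real (card F3) + 1) - \<alpha>3
    + 2 * \<alpha>1 * sqrt (2 * \<alpha>1 + 1) - \<alpha>1"
proof -
  have ud: "uniquely_determined F1" "uniquely_determined F1'"
    using assms by (auto simp: ud_neighbour_def)
  then have fin: "finite F1" "finite F1'" by (auto simp: uniquely_determined_def)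
  have "card (sym_diff F2 F3) \<le> card (sym_diff F1 F2 \<union> sym_diff F1' F3 \<union> sym_diff F1 F1')"
    using assms(1,2) fin by (intro card_mono) auto
  also have "\<dots> \<le> card (sym_diff F1 F2) + card (sym_diff F1' F3) + card (sym_diff F1 F1')"
    by (meson add_le_mono card_Un_le le_refl order_trans)
  finally have "real (card (sym_diff F2 F3))
      \<le> real (card (sym_diff F1 F2)) + real (card (sym_diff F1' F3)) + real (card (sym_diff F1 F1'))"
    by linarith
  moreover have "real (card (sym_diff F1 F2)) \<le> \<alpha>2 * sqrt (8 * real (card F2) + 1) - \<alpha>2"
    using card_sym_diff_neighbour_le assms by blast
  moreover have "real (card (sym_diff F1' F3)) \<le> \<alpha>3 * sqrt (8 * real (card F3) + 1) - \<alpha>3"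
    using card_sym_diff_neighbour_le assms by blast
  moreover have "real (card (sym_diff F1 F1')) \<le> 2 * \<alpha>1 * sqrt (2 * \<alpha>1 + 1) - \<alpha>1"
  proof -
    \<comment> \<open>Enlarging \<open>8 * \<alpha>1 + 1\<close> to \<open>8 * \<alpha>1 + 4\<close>
      brings the sharper bound into the required form.\<close>
    have "sqrt (8 * \<alpha>1 + 1) \<le> sqrt (2\<^sup>2 * (2 * \<alpha>1 + 1))" by simp
    also have "\<dots> = 2 * sqrt (2 * \<alpha>1 + 1)" by (simp only: real_sqrt_mult real_sqrt_abs)
    finally have "\<alpha>1 * (sqrt (8 * \<alpha>1 + 1) - 1) \<le> \<alpha>1 * (2 * sqrt (2 * \<alpha>1 + 1) - 1)"
      using alpha_nonneg assms(7) by (intro mult_left_mono) auto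
    then show ?thesis
      using card_sym_diff_uniquely_determined_le[OF ud] assms(7) by (simp add: algebra_simps)
  qed
  ultimately show ?thesis by linarith
qed

end
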